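(* Let $E$ be the figure-eight knot, let $J_N(E;q)$ be its $N$-dimensional colored Jones polynomial, and let $\kappa:=\log\left(\frac{3+\sqrt5}{2}\right)$. If $\xi$ is a real number with $|\xi|>\kappa$, then $$J_N\left(E;e^{\xi/N}\right)\underset{N\to\infty}{\sim}\frac{\sqrt{\pi}}{2\sinh(|\xi|/2)}\,T(\xi)^{1/2}\left(\frac{N}{|\xi|}\right)^{1/2}\exp\left(\frac{N}{|\xi|}S(|\xi|)\right),$$ that is, the ratio of the two sides tends to $1$ as the integer $N$ tends to infinity.
   Context: The colored Jones polynomial $J_N(K;q)$ of a knot $K\subset S^3$ ($N\ge 2$ an integer) is the one associated with the $N$-dimensional irreducible representation of $\mathfrak{sl}(2;\mathbb{C})$, normalized so that it equals $1$ for the unknot and $J_2$ is the Jones polynomial. For the figure-eight knot $E$ the known Habiro–Le formula, which may be taken as the definition, is $$J_N(E;q)=\sum_{k=0}^{N-1}q^{-kN}\prod_{l=1}^{k}\left(1-q^{N-l}\right)\left(1-q^{N+l}\right).$$ For real $\xi$ with $|\xi|>\kappa$, put $$\varphi(\xi):=\operatorname{arccosh}\left(\cosh\xi-\tfrac12\right)=\log\left(\cosh\xi-\tfrac12+\tfrac12\sqrt{(2\cosh\xi-1)^2-4}\right)>0,$$ $$T(\xi):=\frac{2}{\sqrt{(2\cosh\xi+1)(2\cosh\xi-3)}}>0.$$ For real $\xi>\kappa$ one has $0<\varphi(\xi)<\xi$, and $$S(\xi):=\operatorname{Li}_2\left(e^{-\xi-\varphi(\xi)}\right)-\operatorname{Li}_2\left(e^{-\xi+\varphi(\xi)}\right)+\xi\varphi(\xi),\qquad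 \operatorname{Li}_2(z):=-\int_0^z\frac{\log(1-x)}{x}\,dx.$$ *)

theory Defs
  imports "HOL-Analysis.Analysis" "HOL-Library.Landau_Symbols"
begin

(* The colored Jones polynomial of the figure-eight knot, evaluated at a nonzero q,
   is defined by the Habiro-Le formula.  Normalization: the unknot has value 1. *)
definition colored_jones_figure_eight :: "nat \<Rightarrow> 'a::field \<Rightarrow> 'a" where
  "colored_jones_figure_eight N q =
     (\<Sum>k<N. q powi (- (int k * int N)) *
        (\<Prod>l=1..k. (1 - q powi (int N - int l)) * (1 - q powi (int N + int l))))"

definition kappa :: real where
  "kappa = ln ((3 + sqrt 5) / 2)"

(* Meaningful for \<bar>\<xi>\<bar> > kappa, equivalently cosh \<xi> > 3/2. *)
definition phi :: "real \<Rightarrow> real" where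
  "phi \<xi> = arcosh (cosh \<xi> - 1 / 2)"

definition T :: "real \<Rightarrow> real" where
  "T \<xi> = 2 / sqrt ((2 * cosh \<xi> + 1) * (2 * cosh \<xi> - 3))"

(* The real dilogarithm, meaningful for z \<le> 1; the integral is oriented. *)
definition Li2 :: "real \<Rightarrow> real" where
  "Li2 z = - (LBINT x=0..z. ln (1 - x) / x)"

(* Used for \<xi> > kappa, where 0 < phi \<xi> < \<xi>, so both arguments of Li2 lie in (0,1). *)
definition S :: "real \<Rightarrow> real" where
  "S \<xi> = Li2 (exp (- \<xi> - phi \<xi>)) - Li2 (exp (- \<xi> + phi \<xi>)) + \<xi> * phi \<xi>"

end

theory Submission
  imports Defs "HOL-Probability.Distributions"
begin

text \<open>
  Absorbing \<open>q\<^sup>-\<^sup>k\<^sup>N\<close> into the product, the \<open>k\<close>-th Habiro-Le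
  term at \<open>q = exp (\<xi> / N)\<close>, \<open>\<xi> > 0\<close>, becomes the
  positive number \<open>\<Prod>l=1..k. exp (f (l / N))\<close> with \<open>f t = ln (2 * cosh \<xi> - 2 * cosh (\<xi> * t))\<close>. As \<open>f\<close> is concave with
  a single zero at \<open>x0 = phi \<xi> / \<xi>\<close>, the terms peak at \<open>k = N * x0\<close> with a Gaussian profile of
  width of order \<open>sqrt N\<close>, and Laplace's method applies. The trapezoidal rule evaluates the peak as
  \<open>exp (N * F x0 - f 0 / 2)\<close> for the primitive \<open>F\<close> of \<open>f\<close>; dilogarithms give \<open>F\<close>, hence \<open>S\<close>, in
  closed form, and \<open>exp (- f 0 / 2)\<close> is the prefactor \<open>1 / (2 * sinh (\<xi> / 2))\<close>.
\<close>

section \<open>The Gaussian integral and the abstract setting for Laplace's method\<close>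

lemma has_bochner_integral_gaussian:
  assumes "c > 0"
  shows "has_bochner_integral lborel (\<lambda>s::real. exp (- (c * s\<^sup>2 / 2))) (sqrt (2 * pi / c))"
proof -
  define \<sigma> where "\<sigma> = 1 / sqrt c"
  have \<sigma>: "\<sigma> > 0" "\<sigma>\<^sup>2 = 1 / c"
    using assms by (auto simp: \<sigma>_def power_divide)
  have "has_bochner_integral lborel (\<lambda>s. sqrt (2 * pi / c) * normal_density 0 \<sigma> s) (sqrt (2 * pi / c) * 1)"
    using \<sigma> by (intro has_bochner_integral_mult_right) (simp add: has_bochner_integral_iff)
  also have "(\<lambda>s. sqrt (2 * pi / c) * normal_density 0 \<sigma> s) = (\<lambda>s. exp (- (c * s\<^sup>2 / 2)))"
    unfolding normal_density_def \<sigma> using assms by (auto simp: field_simps)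
  finally show ?thesis by simp
qed

text \<open>Concavity of \<open>f\<close> is encoded by an antitone \<open>f'\<close>. The point 1
  is left out because in the application \<open>f\<close> tends to minus infinity there. The sign
  change of \<open>f\<close> at \<open>x0\<close> makes the partial sums of \<open>f (l / N)\<close>
  peak near \<open>l = N * x0\<close>, and \<open>f' x0 < 0\<close> makes the peak Gaussian.\<close>

locale concave_profile =
  fixes f f' F :: "real \<Rightarrow> real" and x0 :: real
  assumes x0: "0 < x0" "x0 < 1"
    and DERIV_F: "\<And>x. 0 \<le> x \<Longrightarrow> x < 1 \<Longrightarrow> (F has_real_derivative f x) (at x)"
    and DERIV_f: "\<And>x. 0 \<le> x \<Longrightarrow> x < 1 \<Longrightarrow> (f has_real_derivative f' x) (at x)"
    and f'_antimono: "\<And>x y. 0 \<le> x \<Longrightarrow> x \<le> y \<Longrightarrow> y < 1 \<Longrightarrow> f' y \<le> f' x"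
    and f'_cont: "isCont f' x0"
    and F_0: "F 0 = 0"
    and f_x0: "f x0 = 0"
    and f'_x0: "f' x0 < 0"
    and f_0: "f 0 > 0"
begin

section \<open>Logarithms of the terms and the trapezoidal rule\<close>

definition log_prod :: "nat \<Rightarrow> nat \<Rightarrow> real" where
  "log_prod N k = (\<Sum>l=1..k. f (real l / real N))"

lemma log_prod_0 [simp]: "log_prod N 0 = 0"
  by (simp add: log_prod_def)

lemma log_prod_Suc [simp]: "log_prod N (Suc k) = log_prod N k + f (real (Suc k) / real N)"
  by (simp add: log_prod_def)

text \<open>Bounding the error by the drop of the monotone \<open>f'\<close> makes the bounds telescope, so that no
  second derivative of \<open>f\<close> is needed.\<close>

lemma trapezoid_error:
  assumes "0 \<le> a" "a < b" "b < 1"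
  shows "0 \<le> F b - F a - (b - a) / 2 * (f a + f b)"
    and "F b - F a - (b - a) / 2 * (f a + f b) \<le> (b - a)\<^sup>2 / 2 * (f' a - f' b)"
proof -
  \<comment> \<open>The error with its right endpoint set free. One mean value step for
    \<open>E\<close> and one for \<open>f\<close> turn it into
    \<open>(b - a) * (z - a) / 2 * (f' w - f' z)\<close> with \<open>a < w < z < b\<close>, and both
    bounds follow from monotonicity.\<close>
  define E where "E x = F x - F a - (x - a) / 2 * (f a + f x)" for x
  define E' where "E' x = (f x - f a) / 2 - (x - a) / 2 * f' x" for x
  have "(E has_real_derivative E' x) (at x)" if "a \<le> x" "x \<le> b" for x
    unfolding E_def E'_def
    using that assms
    by (auto intro!: derivative_eq_intros DERIV_F DERIV_f simp: field_simps)
  from MVT2[OF \<open>a < b\<close> this] obtain z where z: "a < z" "z < b" and Ez: "E b - E a = (b - a) * E' z"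
    by blast
  have "(f has_real_derivative f' x) (at x)" if "a \<le> x" "x \<le> z" for x
    using that assms z by (intro DERIV_f) auto
  from MVT2[OF z(1) this] obtain w where w: "a < w" "w < z" and fw: "f z - f a = (z - a) * f' w"
    by blast
  have E': "E' z = (z - a) / 2 * (f' w - f' z)"
    unfolding E'_def fw by (simp add: field_simps)
  have mono: "f' z \<le> f' w" "f' w \<le> f' a" "f' b \<le> f' z"
    using w z assms by (auto intro!: f'_antimono)
  have "0 \<le> E' z"
    unfolding E' using mono z by simp
  moreover have "E' z \<le> (b - a) / 2 * (f' a - f' b)"
    unfolding E' using mono z by (intro mult_mono) auto
  ultimately have "0 \<le> (b - a) * E' z" "(b - a) * E' z \<le> (b - a) * ((b - a) / 2 * (f' a - f' b))"
    using assms by (auto intro!: mult_left_mono)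
  moreover have "E a = 0"
    by (simp add: E_def)
  ultimately have "0 \<le> E b" "E b \<le> (b - a)\<^sup>2 / 2 * (f' a - f' b)"
    using Ez by (auto simp: power2_eq_square)
  then show "0 \<le> F b - F a - (b - a) / 2 * (f a + f b)"
    and "F b - F a - (b - a) / 2 * (f a + f b) \<le> (b - a)\<^sup>2 / 2 * (f' a - f' b)"
    by (simp_all add: E_def)
qed

text \<open>Adds up the error over the cells of length \<open>1 / N\<close>; the differences of
  \<open>f'\<close> telescope. The trapezoidal rule gives both endpoints weight one half, whereas
  \<open>log_prod\<close> omits \<open>f 0\<close> and counts \<open>f (k / N)\<close> fully, hence
  the term \<open>(f (k / N) - f 0) / 2\<close>.\<close>

lemma log_prod_trapezoid:
  assumes "k < N"
  shows "0 \<le> N * F (k / N) + (f (k / N) - f 0) / 2 - log_prod N k"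
    and "N * F (k / N) + (f (k / N) - f 0) / 2 - log_prod N k \<le> (f' 0 - f' (k / N)) / (2 * N)"
  using assms
proof (induction k)
  case 0
  { case 1 then show ?case by (simp add: F_0) }
  { case 2 then show ?case by (simp add: F_0) }
next
  case (Suc k)
  define a b where "a = real k / N" and "b = real (Suc k) / N"
  have N: "real N > 0" if "Suc k < N" using that by simp
  have ab: "0 \<le> a" "a < b" "b < 1" "b - a = 1 / N" if "Suc k < N"
    using that by (auto simp: a_def b_def field_simps)
  have step: "N * F b + (f b - f 0) / 2 - log_prod N (Suc k)
      = N * F a + (f a - f 0) / 2 - log_prod N k + N * (F b - F a - (b - a) / 2 * (f a + f b))"
    if "Suc k < N"
    unfolding ab(4)[OF that] log_prod_Suc b_def[symmetric]
    using N[OF that] by (simp add: field_simps)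
  { case 1
    have "0 \<le> N * (F b - F a - (b - a) / 2 * (f a + f b))"
      using ab[OF 1] by (intro mult_nonneg_nonneg trapezoid_error) auto
    then show ?case
      using Suc.IH(1) 1 step[OF 1] unfolding a_def b_def by linarith }
  { case 2
    have "N * (F b - F a - (b - a) / 2 * (f a + f b)) \<le> N * ((b - a)\<^sup>2 / 2 * (f' a - f' b))"
      using ab[OF 2] by (intro mult_left_mono trapezoid_error) auto
    also have "\<dots> = (f' a - f' b) / (2 * N)"
      unfolding ab(4)[OF 2] using N[OF 2] by (simp add: field_simps power2_eq_square)
    finally have "N * (F b - F a - (b - a) / 2 * (f a + f b)) \<le> (f' a - f' b) / (2 * N)" .
    then show ?case
      using Suc.IH(2) 2 step[OF 2] unfolding a_def b_def by (simp add: diff_divide_distrib) }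
qed

section \<open>Local behaviour of the terms near the peak\<close>

lemma F_taylor:
  assumes "0 < x" "x < 1"
  shows "\<exists>z. \<bar>z - x0\<bar> \<le> \<bar>x - x0\<bar> \<and> F x = F x0 + f' z * (x - x0)\<^sup>2 / 2"
proof (cases "x = x0")
  case False
  define a b where "a = min x x0" and "b = max x x0"
  define d where "d m = (if m = 0 then F else if m = 1 then f else f')" for m :: nat
  have "\<exists>t. (if x < x0 then x < t \<and> t < x0 else x0 < t \<and> t < x) \<and>
      F x = (\<Sum>m<2. (d m x0 / fact m) * (x - x0)^m) + (d 2 t / fact 2) * (x - x0)^2"
  proof (rule Taylor)
    show "\<forall>m t. m < 2 \<and> a \<le> t \<and> t \<le> b \<longrightarrow> DERIV (d m) t :> d (Suc m) t"
    proof (intro allI impI)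
      fix m :: nat and t assume "m < 2 \<and> a \<le> t \<and> t \<le> b"
      then have "m = 0 \<or> m = 1" "0 \<le> t" "t < 1"
        using assms x0 by (auto simp: a_def b_def)
      then show "DERIV (d m) t :> d (Suc m) t"
        by (auto simp: d_def DERIV_F DERIV_f)
    qed
  qed (use False in \<open>auto simp: d_def a_def b_def\<close>)
  then obtain t where "if x < x0 then x < t \<and> t < x0 else x0 < t \<and> t < x"
    "F x = (\<Sum>m<2. (d m x0 / fact m) * (x - x0)^m) + (d 2 t / fact 2) * (x - x0)^2"
    by blast
  then show ?thesis
    by (intro exI[of _ t]) (auto simp: d_def f_x0 numeral_2_eq_2 split: if_splits)
qed auto

text \<open>Concerns indices \<open>N * x0 + s * sqrt N + o(sqrt N)\<close>. The Taylor expansion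
  has no linear term as \<open>f x0 = 0\<close>, which leaves the quadratic one; the endpoint
  correction tends to \<open>- f 0 / 2\<close>; the trapezoidal error is of order
  \<open>1 / N\<close>.\<close>

lemma log_prod_tendsto:
  fixes k :: "nat \<Rightarrow> nat"
  assumes k: "(\<lambda>N. sqrt N * (k N / N - x0)) \<longlonglongrightarrow> s"
  shows "(\<lambda>N. log_prod N (k N) - N * F x0) \<longlonglongrightarrow> f' x0 * s\<^sup>2 / 2 - f 0 / 2"
proof -
  have "(\<lambda>N. inverse (sqrt N) * (sqrt N * (k N / N - x0))) \<longlonglongrightarrow> 0 * s"
    by (intro tendsto_mult k tendsto_inverse_0_at_top filterlim_compose[OF sqrt_at_top]
        filterlim_real_sequentially)
  moreover have "\<forall>\<^sub>F N in sequentially. inverse (sqrt N) * (sqrt N * (k N / N - x0)) = k N / N - x0"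
    using eventually_gt_at_top[of 0] by eventually_elim simp
  ultimately have "(\<lambda>N. k N / N - x0) \<longlonglongrightarrow> 0"
    by (simp add: filterlim_cong)
  then have lim: "(\<lambda>N. k N / N) \<longlonglongrightarrow> x0"
    by (simp add: LIM_zero_iff)
  have ev: "\<forall>\<^sub>F N in sequentially. 0 < k N / N \<and> k N / N < 1"
    using order_tendstoD[OF lim] x0 by (auto intro: eventually_conj)
  \<comment> \<open>A choice of Taylor remainder points. No regularity of \<open>z\<close> is
    needed: \<open>z x\<close> is no farther from \<open>x0\<close> than \<open>x\<close>, so
    continuity of \<open>f'\<close> at \<open>x0\<close> gives the limit.\<close>
  have "\<exists>z. \<forall>x. 0 < x \<and> x < 1 \<longrightarrow> \<bar>z x - x0\<bar> \<le> \<bar>x - x0\<bar> \<and> F x = F x0 + f' (z x) * (x - x0)\<^sup>2 / 2"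
    using F_taylor by metis
  then obtain z where z: "\<And>x. 0 < x \<Longrightarrow> x < 1 \<Longrightarrow> \<bar>z x - x0\<bar> \<le> \<bar>x - x0\<bar>"
    "\<And>x. 0 < x \<Longrightarrow> x < 1 \<Longrightarrow> F x = F x0 + f' (z x) * (x - x0)\<^sup>2 / 2"
    by blast
  have "(\<lambda>N. z (k N / N) - x0) \<longlonglongrightarrow> 0"
    by (rule Lim_null_comparison[OF _ tendsto_rabs_zero[OF \<open>(\<lambda>N. k N / N - x0) \<longlonglongrightarrow> 0\<close>]])
      (use ev in eventually_elim, simp add: z)
  then have "(\<lambda>N. z (k N / N)) \<longlonglongrightarrow> x0"
    by (simp add: LIM_zero_iff)
  then have f'z: "(\<lambda>N. f' (z (k N / N))) \<longlonglongrightarrow> f' x0"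
    by (rule isCont_tendsto_compose[OF f'_cont])
  have "(\<lambda>N. f' (z (k N / N)) * (sqrt N * (k N / N - x0))\<^sup>2 / 2) \<longlonglongrightarrow> f' x0 * s\<^sup>2 / 2"
    by (intro tendsto_intros f'z k) auto
  moreover have "\<forall>\<^sub>F N in sequentially.
      f' (z (k N / N)) * (sqrt N * (k N / N - x0))\<^sup>2 / 2 = N * F (k N / N) - N * F x0"
    using ev
  proof eventually_elim
    case (elim N)
    have "f' (z (k N / N)) * (sqrt N * (k N / N - x0))\<^sup>2 / 2
        = N * (f' (z (k N / N)) * (k N / N - x0)\<^sup>2 / 2)"
      unfolding power_mult_distrib by simp
    also have "f' (z (k N / N)) * (k N / N - x0)\<^sup>2 / 2 = F (k N / N) - F x0"
      using z(2)[of "k N / N"] elim by linarith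
    finally show ?case
      by (simp add: right_diff_distrib)
  qed
  ultimately have 1: "(\<lambda>N. N * F (k N / N) - N * F x0) \<longlonglongrightarrow> f' x0 * s\<^sup>2 / 2"
    by (rule Lim_transform_eventually)
  have "isCont f x0"
    using DERIV_f[of x0] x0 by (auto intro: DERIV_isCont)
  then have "(\<lambda>N. f (k N / N)) \<longlonglongrightarrow> 0"
    using isCont_tendsto_compose[OF _ lim, of f] by (simp add: f_x0)
  then have "(\<lambda>N. (f (k N / N) - f 0) / 2) \<longlonglongrightarrow> (0 - f 0) / 2"
    by (intro tendsto_intros) auto
  note 2 = tendsto_add[OF 1 this]
  have f'k: "(\<lambda>N. f' (k N / N)) \<longlonglongrightarrow> f' x0"
    by (rule isCont_tendsto_compose[OF f'_cont lim])
  have 3: "(\<lambda>N. N * F (k N / N) + (f (k N / N) - f 0) / 2 - log_prod N (k N)) \<longlonglongrightarrow> 0"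
  proof (rule Lim_null_comparison)
    show "\<forall>\<^sub>F N in sequentially. norm (N * F (k N / N) + (f (k N / N) - f 0) / 2 - log_prod N (k N))
        \<le> (f' 0 - f' (k N / N)) / 2 * inverse N"
      using ev eventually_gt_at_top[of 0]
    proof eventually_elim
      case (elim N)
      then have "k N < N" by (simp add: field_simps)
      from log_prod_trapezoid[OF this] show ?case
        by (simp add: field_simps)
    qed
    have "(\<lambda>N. (f' 0 - f' (k N / N)) / 2 * inverse (real N)) \<longlonglongrightarrow> (f' 0 - f' x0) / 2 * 0"
      by (intro tendsto_intros f'k lim_inverse_n) auto
    then show "(\<lambda>N. (f' 0 - f' (k N / N)) / 2 * inverse (real N)) \<longlonglongrightarrow> 0"
      by simp
  qed
  from tendsto_diff[OF 2 3] show ?thesis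
    by (simp add: algebra_simps)
qed

section \<open>Gaussian bounds for the terms away from the peak\<close>

text \<open>A slope that serves on both sides of \<open>x0\<close>. To the right, \<open>f\<close>
  lies below its tangent at \<open>x0\<close>, of slope \<open>f' x0\<close>; to the left, it lies
  above its chord over \<open>[0, x0]\<close>, of slope \<open>- f 0 / x0\<close>.\<close>

definition decay :: real where
  "decay = min (- f' x0) (f 0 / x0)"

lemma decay_pos: "decay > 0"
  using x0 f'_x0 f_0 by (simp add: decay_def)

lemma f_le_right:
  assumes "x0 \<le> t" "t < 1"
  shows "f t \<le> - decay * (t - x0)"
proof (cases "t = x0")
  case False
  with assms have "x0 < t" by simp
  have "(f has_real_derivative f' x) (at x)" if "x0 \<le> x" "x \<le> t" for x
    using that assms x0 by (intro DERIV_f) auto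
  from MVT2[OF \<open>x0 < t\<close> this] obtain z where z: "x0 < z" "z < t" "f t - f x0 = (t - x0) * f' z"
    by blast
  have "f' z \<le> f' x0"
    using z x0 assms by (intro f'_antimono) auto
  then have "f' z \<le> - decay"
    by (simp add: decay_def)
  then have "(t - x0) * f' z \<le> (t - x0) * (- decay)"
    using assms by (intro mult_left_mono) auto
  then show ?thesis
    using z f_x0 by (simp add: mult.commute)
qed (simp add: f_x0)

lemma f_ge_left:
  assumes "0 \<le> t" "t \<le> x0"
  shows "decay * (x0 - t) \<le> f t"
proof -
  have "convex_on {0..x0} (\<lambda>x. - f x)"
  proof (rule convex_on_realI)
    show "((\<lambda>x. - f x) has_real_derivative - f' x) (at x)" if "x \<in> {0..x0}" for x
      using that x0 by (intro derivative_intros DERIV_f) auto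
  qed (use x0 in \<open>auto intro: f'_antimono\<close>)
  \<comment> \<open>The chord bound; the chord ends at height \<open>f x0 = 0\<close>.\<close>
  from convex_onD_Icc'[OF this, of t] have "f 0 - f 0 / x0 * t \<le> f t"
    using assms f_x0 by simp
  also have "f 0 - f 0 / x0 * t = f 0 / x0 * (x0 - t)"
    using x0 by (simp add: field_simps)
  finally have "f 0 / x0 * (x0 - t) \<le> f t" .
  moreover have "decay * (x0 - t) \<le> f 0 / x0 * (x0 - t)"
    using assms by (intro mult_right_mono) (auto simp: decay_def)
  ultimately show ?thesis
    by linarith
qed

text \<open>The summand with index \<open>m + i + 1\<close> is taken at least \<open>i / N\<close>
  to the right of \<open>x0\<close>, so it is at most \<open>- decay * i / N\<close>. Summation over
  \<open>i < j\<close> gives \<open>j * (j - 1) / 2\<close>.\<close>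

lemma log_prod_right_le:
  assumes "N * x0 < real m + 1" "m + j < N"
  shows "log_prod N (m + j) \<le> log_prod N m - decay * (real j * (real j - 1) / (2 * N))"
  using assms(2)
proof (induction j)
  case (Suc j)
  define t where "t = real (Suc (m + j)) / N"
  have N: "real N > 0" using Suc.prems by simp
  have "x0 + real j / N = (N * x0 + j) / N"
    using N by (simp add: field_simps)
  also have "\<dots> \<le> t"
    unfolding t_def using assms(1) by (intro divide_right_mono) auto
  finally have t: "x0 + real j / N \<le> t" "t < 1"
    using Suc.prems N by (auto simp: t_def)
  have "f t \<le> - decay * (t - x0)"
    using t N by (intro f_le_right) (auto intro: order_trans[rotated])
  also have "\<dots> \<le> - (decay * (j / N))"
    using t decay_pos by (simp only: minus_mult_left[symmetric] neg_le_iff_le)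
      (intro mult_left_mono, auto)
  finally have "f t \<le> - (decay * (j / N))" .
  moreover have "decay * (real (Suc j) * (real (Suc j) - 1) / (2 * N))
      = decay * (real j * (real j - 1) / (2 * N)) + decay * (j / N)"
    using N by (simp add: field_simps)
  ultimately show ?case
    using Suc.IH Suc.prems by (simp add: t_def)
qed simp

text \<open>The mirror image: going down from \<open>m\<close> removes the summands with index
  \<open>m - i\<close>, \<open>i < j\<close>, each at least \<open>decay * i / N\<close>.\<close>

lemma log_prod_left_le:
  assumes "real m \<le> N * x0" "j \<le> m" "N > 0"
  shows "log_prod N (m - j) \<le> log_prod N m - decay * (real j * (real j - 1) / (2 * N))"
  using assms(2)
proof (induction j)
  case (Suc j)
  define t where "t = real (m - j) / N"
  have N: "real N > 0" using assms by simp
  have t: "0 \<le> t" "t \<le> x0 - real j / N"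
    using assms(1) Suc.prems N by (auto simp: t_def field_simps)
  have "decay * (j / N) \<le> decay * (x0 - t)"
    using t decay_pos by (intro mult_left_mono) auto
  also have "\<dots> \<le> f t"
    using t N by (intro f_ge_left) (auto intro: order_trans)
  finally have "decay * (j / N) \<le> f t" .
  moreover have "decay * (real (Suc j) * (real (Suc j) - 1) / (2 * N))
      = decay * (real j * (real j - 1) / (2 * N)) + decay * (j / N)"
    using N by (simp add: field_simps)
  moreover have "log_prod N (m - j) = log_prod N (m - Suc j) + f t"
    using log_prod_Suc[of N "m - Suc j"] Suc.prems by (simp add: t_def Suc_diff_Suc)
  ultimately show ?case
    using Suc.IH Suc.prems by simp
qed simp

text \<open>Here \<open>s\<close> is any point of the rescaled cell of \<open>k\<close>, not just
  its left end, as domination of \<open>step_fun\<close> requires. Since \<open>m\<close> and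
  \<open>k\<close> are roundings, the distance \<open>p\<close> from the peak index is at least
  \<open>\<bar>s\<bar> * sqrt N - 1\<close>. Giving up constant factors yields
  \<open>p * (p - 1) \<ge> s\<^sup>2 * N / 4 - 1\<close>; weakening \<open>- 1\<close> to
  \<open>- N\<close> and dividing by \<open>2 * N\<close> produces the constants 1/8 and 1/2,
  uniformly in \<open>N\<close>.\<close>

lemma log_prod_le_gaussian:
  assumes "k < N" and s: "(k - N * x0) / sqrt N \<le> s" "s < (real k + 1 - N * x0) / sqrt N"
  shows "log_prod N k \<le> log_prod N (nat \<lfloor>N * x0\<rfloor>) + decay / 2 - decay * s\<^sup>2 / 8"
proof -
  define m where "m = nat \<lfloor>N * x0\<rfloor>"
  define p where "p = \<bar>real k - real m\<bar>"
  have N: "real N \<ge> 1" using assms by simp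
  have m: "real m \<le> N * x0" "N * x0 < real m + 1"
    using x0 by (auto simp: m_def)
  have "log_prod N k \<le> log_prod N m - decay * (p * (p - 1) / (2 * N))"
  proof (cases "m \<le> k")
    case True
    then show ?thesis
      using log_prod_right_le[OF m(2), of "k - m"] assms by (simp add: p_def of_nat_diff)
  next
    case False
    then show ?thesis
      using log_prod_left_le[OF m(1), of "m - k"] assms by (simp add: p_def of_nat_diff)
  qed
  moreover have "s\<^sup>2 / 8 - 1 / 2 \<le> p * (p - 1) / (2 * N)"
  proof -
    define y where "y = \<bar>s\<bar> * sqrt N"
    have y2: "y\<^sup>2 = s\<^sup>2 * N"
      by (simp add: y_def power_mult_distrib)
    have "k - N * x0 \<le> s * sqrt N" "s * sqrt N < real k + 1 - N * x0"
      using s N by (auto simp: field_simps)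
    moreover have "y = \<bar>s * sqrt N\<bar>"
      by (simp add: y_def abs_mult)
    ultimately have "y - 1 \<le> p"
      unfolding p_def using m by linarith
    have "y\<^sup>2 / 2 - 1 \<le> p\<^sup>2"
    proof (cases "1 \<le> y")
      case True
      then have "(y - 1)\<^sup>2 \<le> p\<^sup>2"
        using \<open>y - 1 \<le> p\<close> by (intro power_mono) auto
      moreover have "y\<^sup>2 / 2 - 1 \<le> (y - 1)\<^sup>2"
        using zero_le_power2[of "y - 2"] by (simp add: power2_eq_square algebra_simps)
      ultimately show ?thesis by linarith
    next
      case False
      then have "y\<^sup>2 \<le> 1"
        by (simp add: y_def power_le_one)
      then show ?thesis
        using zero_le_power2[of p] by linarith
    qed
    moreover have "p\<^sup>2 / 2 - 1 / 2 \<le> p * (p - 1)"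
      using zero_le_power2[of "p - 1"] by (simp add: power2_eq_square algebra_simps)
    ultimately have "s\<^sup>2 * N / 4 - 1 \<le> p * (p - 1)"
      using y2 by linarith
    then have "(s\<^sup>2 * N / 4 - N) \<le> p * (p - 1)"
      using N by linarith
    then show ?thesis
      using N by (simp add: field_simps)
  qed
  then have "decay * (s\<^sup>2 / 8 - 1 / 2) \<le> decay * (p * (p - 1) / (2 * N))"
    using decay_pos by (intro mult_left_mono) auto
  moreover have "decay * (s\<^sup>2 / 8 - 1 / 2) = decay * s\<^sup>2 / 8 - decay / 2"
    by (simp add: right_diff_distrib)
  ultimately show ?thesis
    unfolding m_def[symmetric] by linarith
qed

section \<open>The sum as an integral, and dominated convergence\<close>

text \<open>The normalized terms as a function of the rescaled index
  \<open>s = (k - N * x0) / sqrt N\<close>. The cells have width \<open>1 / sqrt N\<close> and are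
  half-open, so that they are disjoint and the active one is found by a floor.\<close>

definition step_fun :: "nat \<Rightarrow> real \<Rightarrow> real" where
  "step_fun N s = (\<Sum>k<N. exp (log_prod N k - N * F x0) *
     indicator {(k - N * x0) / sqrt N..<(real k + 1 - N * x0) / sqrt N} s)"

lemma step_fun_eq:
  fixes N s
  assumes "N > 0"
  defines "j \<equiv> \<lfloor>N * x0 + s * sqrt N\<rfloor>"
  shows "step_fun N s = (if 0 \<le> j \<and> j < int N then exp (log_prod N (nat j) - N * F x0) else 0)"
proof -
  have iff: "s \<in> {(k - N * x0) / sqrt N..<(real k + 1 - N * x0) / sqrt N} \<longleftrightarrow> int k = j" for k
  proof -
    have "s \<in> {(k - N * x0) / sqrt N..<(real k + 1 - N * x0) / sqrt N} \<longleftrightarrow>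
        of_int (int k) \<le> N * x0 + s * sqrt N \<and> N * x0 + s * sqrt N < of_int (int k) + 1"
      using assms by (auto simp: field_simps)
    also have "\<dots> \<longleftrightarrow> int k = j"
      unfolding j_def using floor_eq_iff[of "N * x0 + s * sqrt N" "int k"] by auto
    finally show ?thesis .
  qed
  have "step_fun N s = (\<Sum>k<N. if int k = j then exp (log_prod N k - N * F x0) else 0)"
    unfolding step_fun_def by (intro sum.cong refl) (simp add: indicator_def iff del: atLeastLessThan_iff)
  also have "\<dots> = (\<Sum>k<N. if 0 \<le> j \<and> k = nat j then exp (log_prod N k - N * F x0) else 0)"
    by (intro sum.cong) auto
  also have "\<dots> = (if 0 \<le> j \<and> j < int N then exp (log_prod N (nat j) - N * F x0) else 0)"
    by (cases "0 \<le> j") (auto simp: nat_less_iff)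
  finally show ?thesis .
qed

lemma integral_step_fun:
  assumes "N > 0"
  shows "(\<integral>s. step_fun N s \<partial>lborel) = (\<Sum>k<N. exp (log_prod N k)) * exp (- (N * F x0)) / sqrt N"
proof -
  have le: "(k - N * x0) / sqrt N \<le> (real k + 1 - N * x0) / sqrt N" for k
    using assms by (simp add: field_simps)
  have "(\<integral>s. step_fun N s \<partial>lborel) = (\<Sum>k<N. exp (log_prod N k - N * F x0) *
     ((real k + 1 - N * x0) / sqrt N - (k - N * x0) / sqrt N))"
    unfolding step_fun_def using le
    by (subst Bochner_Integration.integral_sum) (auto simp del: mult_indicator_subset)
  also have "\<dots> = (\<Sum>k<N. exp (log_prod N k) * (exp (- (N * F x0)) / sqrt N))"
    by (intro sum.cong) (simp_all flip: diff_divide_distrib add: exp_diff exp_minus field_simps)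
  finally show ?thesis
    by (simp add: sum_distrib_right sum_divide_distrib)
qed

text \<open>For fixed \<open>s\<close> the active index is \<open>N * x0 + s * sqrt N\<close> up to
  rounding, which moves the rescaled index by at most \<open>1 / sqrt N\<close>; hence the local
  limit \<open>log_prod_tendsto\<close> applies.\<close>

lemma step_fun_tendsto:
  "(\<lambda>N. step_fun N s) \<longlonglongrightarrow> exp (f' x0 * s\<^sup>2 / 2 - f 0 / 2)"
proof -
  define j where "j N = \<lfloor>real N * x0 + s * sqrt N\<rfloor>" for N :: nat
  have sqrt_top: "filterlim (\<lambda>N. sqrt (real N)) at_top sequentially"
    by (intro filterlim_compose[OF sqrt_at_top] filterlim_real_sequentially)
  \<comment> \<open>The first threshold forces \<open>0 \<le> j N\<close>, the second
    \<open>j N < N\<close>.\<close>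
  have "\<forall>\<^sub>F N in sequentially. sqrt (real N) > \<bar>s\<bar> / x0"
    "\<forall>\<^sub>F N in sequentially. sqrt (real N) > \<bar>s\<bar> / (1 - x0)"
    using sqrt_top by (auto simp: filterlim_at_top_dense)
  then have ev: "\<forall>\<^sub>F N in sequentially. 0 < N \<and> 0 \<le> j N \<and> j N < int N"
    using eventually_gt_at_top[of 0]
  proof eventually_elim
    case (elim N)
    have "\<bar>s\<bar> < sqrt N * x0" "\<bar>s\<bar> < sqrt N * (1 - x0)"
      using elim x0 by (auto simp: pos_divide_less_eq)
    then have "\<bar>s\<bar> * sqrt N \<le> sqrt N * x0 * sqrt N" "\<bar>s\<bar> * sqrt N < sqrt N * (1 - x0) * sqrt N"
      using elim by (intro mult_right_mono mult_strict_right_mono; simp)+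
    then have "\<bar>s * sqrt N\<bar> \<le> N * x0" "\<bar>s * sqrt N\<bar> < N * (1 - x0)"
      by (simp_all add: abs_mult mult_ac)
    then show ?case
      using elim unfolding j_def by (auto simp: floor_less_iff algebra_simps)
  qed
  have "(\<lambda>N. sqrt N * (nat (j N) / N - x0)) \<longlonglongrightarrow> s"
  proof (rule LIM_zero_cancel, rule Lim_null_comparison)
    show "\<forall>\<^sub>F N in sequentially. norm (sqrt N * (nat (j N) / N - x0) - s) \<le> inverse (sqrt N)"
      using ev
    proof eventually_elim
      case (elim N)
      define r where "r = real_of_int (j N) - (N * x0 + s * sqrt N)"
      have "\<bar>r\<bar> \<le> 1"
        unfolding r_def j_def by linarith
      define w where "w = sqrt N"
      have w: "w > 0" "real N = w * w"
        using elim by (simp_all add: w_def)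
      have "real (nat (j N)) = r + w * w * x0 + s * w"
        using elim w(2) by (simp add: r_def w_def)
      then have "w * (nat (j N) / N - x0) - s = r / w"
        unfolding w(2) using w(1) by (simp add: field_simps)
      then have eq: "sqrt N * (nat (j N) / N - x0) - s = r / sqrt N"
        by (simp add: w_def)
      show ?case
        unfolding eq using \<open>\<bar>r\<bar> \<le> 1\<close> elim by (simp add: abs_divide field_simps)
    qed
    show "(\<lambda>N. inverse (sqrt (real N))) \<longlonglongrightarrow> 0"
      by (rule tendsto_inverse_0_at_top[OF sqrt_top])
  qed
  from tendsto_exp[OF log_prod_tendsto[OF this]]
  have "(\<lambda>N. exp (log_prod N (nat (j N)) - N * F x0)) \<longlonglongrightarrow> exp (f' x0 * s\<^sup>2 / 2 - f 0 / 2)" .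
  moreover have "\<forall>\<^sub>F N in sequentially. exp (log_prod N (nat (j N)) - N * F x0) = step_fun N s"
    using ev by eventually_elim (simp add: step_fun_eq j_def)
  ultimately show ?thesis
    by (rule Lim_transform_eventually)
qed

text \<open>The value at \<open>s = 0\<close> is the term at the peak index
  \<open>\<lfloor>N * x0\<rfloor>\<close>. It converges, so it is bounded in \<open>N\<close>, and
  \<open>log_prod_le_gaussian\<close> compares every other term with it.\<close>

lemma step_fun_bounded:
  obtains C where "\<And>N s. \<bar>step_fun N s\<bar> \<le> C * exp (- (decay * s\<^sup>2 / 8))"
proof -
  obtain B where B: "\<bar>step_fun N 0\<bar> \<le> B" for N
    using convergent_imp_Bseq[OF convergentI[OF step_fun_tendsto[of 0]]] by (auto simp: Bseq_def)
  have "\<bar>step_fun N s\<bar> \<le> (B * exp (decay / 2)) * exp (- (decay * s\<^sup>2 / 8))" for N s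
  proof (cases "step_fun N s = 0")
    case True
    then show ?thesis
      using B[of N] by simp
  next
    case False
    then have N: "N > 0"
      by (cases N) (auto simp: step_fun_def)
    define j where "j = \<lfloor>N * x0 + s * sqrt N\<rfloor>"
    have j: "0 \<le> j" "j < int N" and step: "step_fun N s = exp (log_prod N (nat j) - N * F x0)"
      using False unfolding step_fun_eq[OF N] j_def by (auto split: if_splits)
    have "\<lfloor>N * x0\<rfloor> < int N"
      using x0 N by (simp add: floor_less_iff)
    then have "exp (log_prod N (nat \<lfloor>N * x0\<rfloor>) - N * F x0) = step_fun N 0"
      using x0 unfolding step_fun_eq[OF N] by simp
    moreover have "real_of_int j \<le> N * x0 + s * sqrt N" "N * x0 + s * sqrt N < real_of_int j + 1"
      unfolding j_def by linarith+
    then have "log_prod N (nat j) \<le> log_prod N (nat \<lfloor>N * x0\<rfloor>) + decay / 2 - decay * s\<^sup>2 / 8"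
      using N j by (intro log_prod_le_gaussian) (auto simp: field_simps)
    then have "exp (log_prod N (nat j) - N * F x0) \<le>
        exp (log_prod N (nat \<lfloor>N * x0\<rfloor>) - N * F x0 + decay / 2 + - (decay * s\<^sup>2 / 8))"
      by simp
    ultimately have "step_fun N s \<le> step_fun N 0 * exp (decay / 2) * exp (- (decay * s\<^sup>2 / 8))"
      unfolding step by (simp only: exp_add)
    also have "\<dots> \<le> B * exp (decay / 2) * exp (- (decay * s\<^sup>2 / 8))"
      using B[of N] by (intro mult_right_mono) auto
    finally show ?thesis
      using step by simp
  qed
  then show thesis by (rule that)
qed

text \<open>The integral of \<open>step_fun\<close> is the sum divided by
  \<open>sqrt N * exp (N * F x0)\<close>, and by dominated convergence it tends to a Gaussian
  integral with the extra factor \<open>exp (- f 0 / 2)\<close>.\<close>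

theorem sum_exp_log_prod_asymp:
  "(\<lambda>N. \<Sum>k<N. exp (log_prod N k)) \<sim>[at_top]
   (\<lambda>N. sqrt (2 * pi / (- f' x0)) * exp (- f 0 / 2) * sqrt N * exp (N * F x0))"
proof -
  obtain C where C: "\<And>N s. \<bar>step_fun N s\<bar> \<le> C * exp (- (decay * s\<^sup>2 / 8))"
    using step_fun_bounded by blast
  have "(\<lambda>N. \<integral>s. step_fun N s \<partial>lborel) \<longlonglongrightarrow> (\<integral>s. exp (f' x0 * s\<^sup>2 / 2 - f 0 / 2) \<partial>lborel)"
  proof (rule integral_dominated_convergence)
    show "integrable lborel (\<lambda>s. C * exp (- (decay * s\<^sup>2 / 8)))"
      using has_bochner_integral_gaussian[of "decay / 4"] decay_pos
      by (auto simp: has_bochner_integral_iff)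
    show "AE s in lborel. (\<lambda>N. step_fun N s) \<longlonglongrightarrow> exp (f' x0 * s\<^sup>2 / 2 - f 0 / 2)"
      by (simp add: step_fun_tendsto)
    show "step_fun N \<in> borel_measurable lborel" for N
      unfolding step_fun_def by measurable
  qed (use C in auto)
  also have "(\<integral>s. exp (f' x0 * s\<^sup>2 / 2 - f 0 / 2) \<partial>lborel)
      = (\<integral>s. exp (- f 0 / 2) * exp (- ((- f' x0) * s\<^sup>2 / 2)) \<partial>lborel)"
    by (intro Bochner_Integration.integral_cong) (simp_all flip: exp_add)
  also have "\<dots> = exp (- f 0 / 2) * sqrt (2 * pi / (- f' x0))"
    using has_bochner_integral_gaussian[of "- f' x0"] f'_x0
    by (simp add: has_bochner_integral_iff)
  finally have lim: "(\<lambda>N. \<integral>s. step_fun N s \<partial>lborel) \<longlonglongrightarrow> exp (- f 0 / 2) * sqrt (2 * pi / (- f' x0))" .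
  define K where "K = exp (- f 0 / 2) * sqrt (2 * pi / (- f' x0))"
  have "K > 0"
    unfolding K_def using f'_x0
    by (intro mult_pos_pos exp_gt_zero real_sqrt_gt_zero divide_pos_pos) auto
  have "(\<lambda>N. (\<integral>s. step_fun N s \<partial>lborel) / K) \<longlonglongrightarrow> K / K"
    using lim \<open>K > 0\<close> unfolding K_def[symmetric] by (intro tendsto_intros) auto
  moreover have "\<forall>\<^sub>F N in sequentially. (\<integral>s. step_fun N s \<partial>lborel) / K =
      (\<Sum>k<N. exp (log_prod N k)) / (sqrt (2 * pi / (- f' x0)) * exp (- f 0 / 2) * sqrt N * exp (N * F x0))"
    using eventually_gt_at_top[of 0]
  proof eventually_elim
    case (elim N)
    have eq: "sqrt (2 * pi / (- f' x0)) * exp (- f 0 / 2) * sqrt N * exp (N * F x0) = K * sqrt N * exp (N * F x0)"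
      by (simp add: K_def)
    show ?case
      unfolding integral_step_fun[OF elim] eq by (simp add: exp_minus field_simps)
  qed
  ultimately have "(\<lambda>N. (\<Sum>k<N. exp (log_prod N k)) /
      (sqrt (2 * pi / (- f' x0)) * exp (- f 0 / 2) * sqrt N * exp (N * F x0))) \<longlonglongrightarrow> K / K"
    by (rule Lim_transform_eventually)
  then show ?thesis
    using \<open>K > 0\<close> by (intro asymp_equivI') simp
qed

end

section \<open>The derivative of the dilogarithm\<close>

lemma Li2_has_real_derivative:
  assumes "0 < z" "z < 1"
  shows "(Li2 has_real_derivative - ln (1 - z) / z) (at z)"
proof -
  \<comment> \<open>At 0 the integrand of \<open>Li2\<close> has the default value 0 of a division
    by zero. Its limit there is -1, and inserting it gives a continuous integrand with the same
    integral.\<close>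
  define h :: "real \<Rightarrow> real" where "h x = (if x = 0 then - 1 else ln (1 - x) / x)" for x
  \<comment> \<open>Room to the right of \<open>z\<close>, so that the derivative within
    \<open>{0..r}\<close> is two-sided.\<close>
  obtain r where r: "z < r" "r < 1"
    using dense assms by blast
  have "isCont h x" if "x < 1" for x
  proof (cases "x = 0")
    case True
    have "((\<lambda>x::real. ln (1 - x)) has_real_derivative - 1) (at 0)"
      by (auto intro!: derivative_eq_intros)
    then have "((\<lambda>x. ln (1 - x) / x) \<longlongrightarrow> - 1) (at (0::real))"
      by (simp add: has_field_derivative_iff)
    then have "(h \<longlongrightarrow> - 1) (at 0)"
      by (rule Lim_transform_eventually) (auto simp: h_def eventually_at_filter)
    then show ?thesis
      using True by (simp add: isCont_def h_def)
  next
    case False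
    have "isCont (\<lambda>x. ln (1 - x) / x) x"
      using that False by (auto intro!: continuous_intros)
    moreover have "\<forall>\<^sub>F y in nhds x. h y = ln (1 - y) / y"
      using t1_space_nhds[OF False] by eventually_elim (simp add: h_def)
    ultimately show ?thesis
      using isCont_cong by fastforce
  qed
  then have "continuous_on {0..r} h"
    using r by (auto intro!: continuous_at_imp_continuous_on)
  then have "((\<lambda>u. LBINT x=0..u. h x) has_vector_derivative h z) (at z within {0..r})"
    unfolding zero_ereal_def using assms r by (intro interval_integral_FTC2[of 0 0 r h z]) auto
  moreover have "at z within {0..r} = at z"
    using assms r by (intro at_within_interior) (auto simp: interior_atLeastAtMost_real)
  ultimately have "((\<lambda>u. LBINT x=0..u. h x) has_real_derivative h z) (at z)"
    by (simp add: has_real_derivative_iff_has_vector_derivative)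
  then have "((\<lambda>u. - (LBINT x=0..u. h x)) has_real_derivative - ln (1 - z) / z) (at z)"
    using assms by (auto intro!: derivative_eq_intros simp: h_def)
  moreover have "(\<lambda>u. - (LBINT x=0..u. h x)) = Li2"
  proof
    fix u :: real
    have "(LBINT x=0..u. h x) = (LBINT x=0..u. ln (1 - x) / x)"
      by (rule interval_integral_cong) (auto simp: h_def einterval_def min_def split: if_splits)
    then show "- (LBINT x=0..u. h x) = Li2 u"
      by (simp add: Li2_def)
  qed
  ultimately show ?thesis by simp
qed

section \<open>The figure-eight profile\<close>

text \<open>The threshold \<open>kappa\<close> satisfies \<open>cosh kappa = 3 / 2\<close>. Beyond
  it the argument of \<open>arcosh\<close> in \<open>phi\<close> exceeds 1, and
  \<open>f 0 = ln (2 * cosh X - 2)\<close> is positive.\<close>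

lemma cosh_gt_if_gt_kappa:
  assumes "X > kappa"
  shows "X > 0" "cosh X > 3 / 2"
proof -
  have pos: "(3 + sqrt 5) / 2 \<ge> 1"
    by simp
  then have "kappa \<ge> 0"
    by (simp add: kappa_def)
  have "cosh kappa = 3 / 2"
  proof -
    have "inverse ((3 + sqrt 5) / 2) = (3 - sqrt 5) / 2"
      by (rule inverse_unique) (simp add: field_simps)
    moreover have "cosh kappa = ((3 + sqrt 5) / 2 + inverse ((3 + sqrt 5) / 2)) / 2"
      unfolding kappa_def using pos by (intro cosh_ln_real) linarith
    ultimately show ?thesis
      by (simp only:) (simp add: field_simps)
  qed
  moreover show "X > 0"
    using \<open>kappa \<ge> 0\<close> assms by simp
  ultimately show "cosh X > 3 / 2"
    using \<open>kappa \<ge> 0\<close> assms cosh_real_nonneg_less_iff[of kappa X] by simp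
qed

text \<open>The first equation says that the factor \<open>2 * cosh X - 2 * cosh u\<close> equals 1
  at \<open>u = phi X\<close>, which locates the peak. The last one relates \<open>T\<close> to the
  slope of \<open>f\<close> there.\<close>

lemma phi_bounds:
  assumes "X > kappa"
  shows "cosh (phi X) = cosh X - 1 / 2" "0 < phi X" "phi X < X" "T X = 1 / sinh (phi X)"
proof -
  define c where "c = cosh X - 1 / 2"
  have c: "c > 1" "phi X = arcosh c"
    using cosh_gt_if_gt_kappa[OF assms] by (auto simp: c_def phi_def)
  show cosh_phi: "cosh (phi X) = cosh X - 1 / 2"
    using c by (simp add: c_def)
  show "0 < phi X"
    using c by simp
  then show "phi X < X"
    using cosh_phi cosh_gt_if_gt_kappa[OF assms] cosh_real_nonneg_less_iff[of "phi X" X] by simp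
  have "(2 * cosh X + 1) * (2 * cosh X - 3) = 2\<^sup>2 * (c\<^sup>2 - 1)"
    by (simp add: c_def power2_eq_square algebra_simps)
  then have "sqrt ((2 * cosh X + 1) * (2 * cosh X - 3)) = 2 * sqrt (c\<^sup>2 - 1)"
    by (simp only: real_sqrt_mult) simp
  then show "T X = 1 / sinh (phi X)"
    unfolding T_def c(2) using c(1) by (simp add: sinh_arcosh_real)
qed

text \<open>Splits the logarithm of a factor into \<open>X\<close> and two terms
  \<open>ln (1 - exp (- X \<plusminus> u))\<close>, whose primitives are dilogarithms.\<close>

lemma two_cosh_diff_factor:
  "2 * cosh X - 2 * cosh u = exp X * (1 - exp (- X - u)) * (1 - exp (- X + u))" for X u :: real
  unfolding cosh_def by (simp add: algebra_simps flip: exp_add)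

lemma cosh_mult_less:
  assumes "X > 0" "0 \<le> t" "t < 1"
  shows "cosh (X * t) < cosh (X::real)"
  using assms cosh_real_nonneg_less_iff[of "X * t" X] by simp

lemma concave_profile_figure_eight:
  fixes X :: real
  assumes "X > kappa"
  shows "concave_profile (\<lambda>t. ln (2 * cosh X - 2 * cosh (X * t)))
    (\<lambda>t. - (2 * X * sinh (X * t)) / (2 * cosh X - 2 * cosh (X * t)))
    (\<lambda>t. (Li2 (exp (- X - X * t)) - Li2 (exp (- X + X * t))) / X + X * t)
    (phi X / X)"
proof
  note X = cosh_gt_if_gt_kappa[OF assms] and phi = phi_bounds[OF assms]
  have phi_eq: "X * (phi X / X) = phi X"
    using X by simp
  have one: "2 * cosh X - 2 * cosh (phi X) = 1"
    using phi by simp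
  show "0 < phi X / X" "phi X / X < 1"
    using X phi by auto
  show "((\<lambda>t. (Li2 (exp (- X - X * t)) - Li2 (exp (- X + X * t))) / X + X * t)
      has_real_derivative ln (2 * cosh X - 2 * cosh (X * t))) (at t)" if "0 \<le> t" "t < 1" for t
  proof -
    have "0 \<le> X * t" "X * t < X"
      using that X by auto
    then have lt: "exp (- X - X * t) < 1" "exp (- X + X * t) < 1"
      using X by auto
    have "ln (exp X * (1 - a) * (1 - b)) = X + ln (1 - a) + ln (1 - b)" if "a < 1" "b < 1" for a b
      using that by (simp add: ln_mult)
    from this[OF lt] have "ln (2 * cosh X - 2 * cosh (X * t))
        = X + ln (1 - exp (- X - X * t)) + ln (1 - exp (- X + X * t))"
      unfolding two_cosh_diff_factor .
    moreover note Li2_has_real_derivative[THEN DERIV_chain2, derivative_intros]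
    have "((\<lambda>t. (Li2 (exp (- X - X * t)) - Li2 (exp (- X + X * t))) / X + X * t)
      has_real_derivative X + ln (1 - exp (- X - X * t)) + ln (1 - exp (- X + X * t))) (at t)"
      using lt X by (auto intro!: derivative_eq_intros simp: field_simps)
    ultimately show ?thesis by simp
  qed
  show "((\<lambda>t. ln (2 * cosh X - 2 * cosh (X * t))) has_real_derivative
      - (2 * X * sinh (X * t)) / (2 * cosh X - 2 * cosh (X * t))) (at t)" if "0 \<le> t" "t < 1" for t
    using cosh_mult_less[of X t] that X by (auto intro!: derivative_eq_intros simp: field_simps)
  show "- (2 * X * sinh (X * t)) / (2 * cosh X - 2 * cosh (X * t))
      \<le> - (2 * X * sinh (X * s)) / (2 * cosh X - 2 * cosh (X * s))" if "0 \<le> s" "s \<le> t" "t < 1" for s t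
  proof -
    \<comment> \<open>Concavity: in \<open>- f'\<close> the numerator grows and the positive
      denominator shrinks.\<close>
    have "cosh (X * s) \<le> cosh (X * t)" "0 \<le> sinh (X * s)" "sinh (X * s) \<le> sinh (X * t)"
      using that X by (auto simp: cosh_real_nonneg_le_iff)
    then have "(2 * X * sinh (X * s)) / (2 * cosh X - 2 * cosh (X * s))
        \<le> (2 * X * sinh (X * t)) / (2 * cosh X - 2 * cosh (X * t))"
      using cosh_mult_less[of X t] that X by (intro frac_le) auto
    then show ?thesis by simp
  qed
  show "isCont (\<lambda>t. - (2 * X * sinh (X * t)) / (2 * cosh X - 2 * cosh (X * t))) (phi X / X)"
    using one phi_eq by (intro continuous_intros) simp_all
  show "ln (2 * cosh X - 2 * cosh (X * (phi X / X))) = 0"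
    unfolding phi_eq one by simp
  show "- (2 * X * sinh (X * (phi X / X))) / (2 * cosh X - 2 * cosh (X * (phi X / X))) < 0"
    unfolding phi_eq one using X phi by simp
  show "ln (2 * cosh X - 2 * cosh (X * 0)) > 0"
    using X by simp
qed simp

section \<open>The Habiro-Le sum and the final asymptotics\<close>

text \<open>The power \<open>q powi (- (k * N))\<close> equals \<open>exp (- \<xi>)\<close> to the
  power \<open>k\<close> and gives one copy to each of the \<open>k\<close> factors. The result is
  even in \<xi>, which permits working with the absolute value.\<close>

lemma colored_jones_figure_eight_exp:
  fixes \<xi> :: real and N :: nat
  assumes "N > 0"
  shows "colored_jones_figure_eight N (exp (\<xi> / N)) =
    (\<Sum>k<N. \<Prod>l=1..k. 2 * cosh \<bar>\<xi>\<bar> - 2 * cosh (\<bar>\<xi>\<bar> * (real l / real N)))"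
  unfolding colored_jones_figure_eight_def
proof (rule sum.cong)
  fix k
  define q where "q = exp (\<xi> / N)"
  have powi: "q powi n = exp (n * (\<xi> / N))" for n
    by (simp add: q_def exp_power_int)
  have "q powi (- (int k * int N)) = (\<Prod>l=1..k. exp (- \<xi>))"
    using assms by (simp add: powi flip: exp_of_nat_mult)
  then have "q powi (- (int k * int N)) * (\<Prod>l=1..k. (1 - q powi (int N - int l)) * (1 - q powi (int N + int l)))
      = (\<Prod>l=1..k. exp (- \<xi>) * ((1 - q powi (int N - int l)) * (1 - q powi (int N + int l))))"
    by (simp only: prod.distrib)
  also have "\<dots> = (\<Prod>l=1..k. 2 * cosh \<bar>\<xi>\<bar> - 2 * cosh (\<bar>\<xi>\<bar> * (real l / real N)))"
  proof (rule prod.cong)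
    fix l
    have "q powi (int N - int l) = exp (\<xi> - \<xi> * (real l / real N))" "q powi (int N + int l) = exp (\<xi> + \<xi> * (real l / real N))"
      using assms by (simp_all add: powi field_simps)
    then have "exp (- \<xi>) * ((1 - q powi (int N - int l)) * (1 - q powi (int N + int l)))
        = 2 * cosh \<xi> - 2 * cosh (\<xi> * (real l / real N))"
      unfolding cosh_def by (simp add: algebra_simps flip: exp_add)
    also have "\<dots> = 2 * cosh \<bar>\<xi>\<bar> - 2 * cosh (\<bar>\<xi>\<bar> * (real l / real N))"
      by (cases "\<xi> \<ge> 0") simp_all
    finally show "exp (- \<xi>) * ((1 - q powi (int N - int l)) * (1 - q powi (int N + int l)))
        = 2 * cosh \<bar>\<xi>\<bar> - 2 * cosh (\<bar>\<xi>\<bar> * (real l / real N))" .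
  qed simp
  finally show "q powi (- (int k * int N)) * (\<Prod>l=1..k. (1 - q powi (int N - int l)) * (1 - q powi (int N + int l)))
      = (\<Prod>l=1..k. 2 * cosh \<bar>\<xi>\<bar> - 2 * cosh (\<bar>\<xi>\<bar> * (real l / real N)))" .
qed simp

theorem theorem1p5:
  fixes \<xi> :: real
  assumes "\<bar>\<xi>\<bar> > kappa"
  shows "(\<lambda>N::nat. colored_jones_figure_eight N (exp (\<xi> / real N))) \<sim>[at_top]
         (\<lambda>N::nat. sqrt pi / (2 * sinh (\<bar>\<xi>\<bar> / 2)) * sqrt (T \<xi>) * sqrt (real N / \<bar>\<xi>\<bar>)
                 * exp (real N / \<bar>\<xi>\<bar> * S \<bar>\<xi>\<bar>))"
proof -
  define X where "X = \<bar>\<xi>\<bar>"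
  have "X > kappa" using assms by (simp add: X_def)
  note X = cosh_gt_if_gt_kappa[OF this] and phi = phi_bounds[OF this]
  define f f' F where "f t = ln (2 * cosh X - 2 * cosh (X * t))"
    and "f' t = - (2 * X * sinh (X * t)) / (2 * cosh X - 2 * cosh (X * t))"
    and "F t = (Li2 (exp (- X - X * t)) - Li2 (exp (- X + X * t))) / X + X * t" for t
  interpret concave_profile f f' F "phi X / X"
    using concave_profile_figure_eight[OF \<open>X > kappa\<close>] unfolding f_def f'_def F_def .
  have asymp: "(\<lambda>N. \<Sum>k<N. exp (log_prod N k)) \<sim>[at_top]
      (\<lambda>N. sqrt pi / (2 * sinh (X / 2)) * sqrt (T X) * sqrt (real N / X) * exp (real N / X * S X))"
  proof -
    have "f' (phi X / X) = - (2 * X * sinh (phi X))"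
      using X phi by (simp add: f'_def)
    \<comment> \<open>The denominator of \<open>f'\<close> is 1 at the peak, and
      \<open>T X = 1 / sinh (phi X)\<close>.\<close>
    then have c: "2 * pi / (- f' (phi X / X)) = pi * T X / X"
      using X phi by (simp add: field_simps)
    have "2 * cosh X - 2 = (2 * sinh (X / 2))\<^sup>2"
      using cosh_double[of "X / 2"] cosh_square_eq[of "X / 2"] by (simp add: power_mult_distrib)
    then have "f 0 = ln ((2 * sinh (X / 2))\<^sup>2)"
      by (simp only: f_def mult_zero_right cosh_0 mult_1_right)
    also have "\<dots> = 2 * ln (2 * sinh (X / 2))"
      using X by (subst ln_realpow) auto
    finally have "exp (f 0 / 2) = 2 * sinh (X / 2)"
      using X by simp
    then have e: "exp (- f 0 / 2) = 1 / (2 * sinh (X / 2))"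
      by (simp add: exp_minus field_simps)
    have F: "F (phi X / X) = S X / X"
      using X by (simp add: F_def S_def field_simps)
    show ?thesis
      using sum_exp_log_prod_asymp unfolding c e F
      by (simp add: real_sqrt_mult real_sqrt_divide mult_ac)
  qed
  have "\<forall>\<^sub>F N in at_top. (\<Sum>k<N. exp (log_prod N k)) = colored_jones_figure_eight N (exp (\<xi> / real N))"
    using eventually_gt_at_top[of 0]
  proof eventually_elim
    case (elim N)
    have "exp (log_prod N k) = (\<Prod>l=1..k. 2 * cosh X - 2 * cosh (X * (real l / real N)))" if "k < N" for k
    proof -
      \<comment> \<open>As \<open>l \<le> k < N\<close>, the argument of the logarithm is positive,
        so \<open>exp\<close> undoes \<open>ln\<close>.\<close>
      have "exp (f (real l / real N)) = 2 * cosh X - 2 * cosh (X * (real l / real N))" if "l \<le> k" for l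
        using cosh_mult_less[of X "l / N"] X that \<open>k < N\<close> by (simp add: f_def)
      then show ?thesis
        unfolding log_prod_def by (simp add: exp_sum)
    qed
    then show ?case
      using elim by (simp add: colored_jones_figure_eight_exp X_def)
  qed
  from asymp_equiv_cong[THEN iffD1, OF this always_eventually asymp] have
    "(\<lambda>N. colored_jones_figure_eight N (exp (\<xi> / real N))) \<sim>[at_top]
      (\<lambda>N. sqrt pi / (2 * sinh (X / 2)) * sqrt (T X) * sqrt (real N / X) * exp (real N / X * S X))"
    by simp
  moreover have "T X = T \<xi>"
    by (simp add: T_def X_def)
  ultimately show ?thesis
    by (simp only: X_def)
qed

end
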